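(* Let $(\mathcal{H},\mathcal{F}_2,\rho)$ be a causal fermion system of spin dimension $n=2$, and let $x,y\in\mathcal{F}_2$ be regular spacetime points, so that $\dim S_x=\dim S_y=4$. Suppose that $S_x$ and $S_y$, with their spin inner products, are identified with $\mathbb{C}^4$ with the Dirac spinor inner product $\prec\psi|\phi\succ=-\psi^\dagger\gamma^0\phi$, and that under these identifications the kernel of the fermionic projector $P(x,y):S_y\to S_x$ has the form $$P(x,y)=i\,\alpha\,\xi_\mu\gamma^\mu+\beta\,\mathbb{1}$$ for some complex numbers $\alpha=\alpha(x,y)$, $\beta=\beta(x,y)$ and some complex vector $\xi=\xi(x,y)\in\mathbb{C}^4$. Then the causal Lagrangian satisfies $$\mathcal{L}(x,y)=4\operatorname{Var}_\Omega\big[\tilde A_{xy}\big],\qquad \operatorname{Var}_\Omega\big[\tilde A_{xy}\big]:=\Big\langle\big(\tilde A_{xy}-\langle\tilde A_{xy}\rangle_\Omega\,\pi_x\big)^2\Big\rangle_\Omega .$$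
   Context: Causal fermion system of spin dimension $n$: $\mathcal{H}$ is a separable complex Hilbert space with scalar product $\langle\cdot|\cdot\rangle$; $\mathcal{F}_n\subset \mathrm{L}(\mathcal{H})$ is the set of all symmetric (self-adjoint) bounded operators of finite rank with (counting multiplicities) at most $n$ positive and at most $n$ negative eigenvalues; $\rho$ is a positive Borel measure on $\mathcal{F}_n$ (norm topology). $x\in\mathcal{F}_n$ is regular if it has exactly $n$ positive and $n$ negative eigenvalues. For $x\in\mathcal{F}_n$: the spin space is $S_x:=x(\mathcal{H})$, $\pi_x:\mathcal{H}\to S_x$ is the orthogonal projection, and the spin inner product on $S_x$ is $\prec u|v\succ_x:=\langle u|xv\rangle$. Kernel of the fermionic projector: $P(x,y):=\pi_x\,y|_{S_y}:S_y\to S_x$. It satisfies $P(y,x)=P(x,y)^*$, the adjoint being taken with respect to the spin inner products on $S_x$, $S_y$. Closed chain: $A_{xy}:=P(x,y)P(y,x)=\pi_x\,y\,x|_{S_x}:S_x\to S_x$. Let $\lambda^{xy}_1,\dots,\lambda^{xy}_{2n}\in\mathbb{C}$ be the non-zero eigenvalues of $xy$ counted with algebraic multiplicity, filled up with zeros (for regular $x,y$ these are the eigenvalues of $A_{xy}$). The points $x,y$ are spacelike separated if all $|\lambda^{xy}_j|$ are equal; timelike separated if all $\lambda^{xy}_j$ are real and not all $|\lambda_j^{xy}|$ are equal; lightlike separated otherwise. Causal Lagrangian: $\mathcal{L}(x,y):=\frac{1}{4n}\sum_{i,j=1}^{2n}\big(|\lambda^{xy}_i|-|\lambda^{xy}_j|\big)^2$.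 Causal correlation operator $\tilde A_{xy}:\mathcal{H}\to\mathcal{H}$: $\tilde A_{xy}:=0$ if $x,y$ are spacelike separated, and $\tilde A_{xy}:=A_{xy}\pi_x$ otherwise. Expectation value in the total system $\Omega$ (the identity on $\mathcal{H}$): $\langle\mathcal{O}\rangle_\Omega:=\frac{1}{2n}\operatorname{tr}_{\mathcal{H}}[\mathcal{O}]$. $\gamma^0,\dots,\gamma^3$ are the Dirac matrices in the standard (Dirac) representation on $\mathbb{C}^4$, with $\gamma^\mu\gamma^\nu+\gamma^\nu\gamma^\mu=2\eta^{\mu\nu}\mathbb{1}$, $\eta=\mathrm{diag}(1,-1,-1,-1)$, $(\gamma^\mu)^\dagger=\gamma^0\gamma^\mu\gamma^0$. *)

theory Defs
  imports "HOL-Analysis.Analysis" "HOL-Library.Multiset"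
begin

section \<open>Complex Hilbert spaces\<close>

class complex_vector = real_vector +
  fixes scaleC :: "complex \<Rightarrow> 'a \<Rightarrow> 'a" (infixr "*\<^sub>C" 75)
  assumes scaleC_add_right: "c *\<^sub>C (u + v) = c *\<^sub>C u + c *\<^sub>C v"
    and scaleC_add_left: "(c + d) *\<^sub>C u = c *\<^sub>C u + d *\<^sub>C u"
    and scaleC_scaleC: "c *\<^sub>C d *\<^sub>C u = (c * d) *\<^sub>C u"
    and scaleC_one: "1 *\<^sub>C u = u"
    and scaleR_scaleC: "r *\<^sub>R u = complex_of_real r *\<^sub>C u"

global_interpretation complex_vector: vector_space "scaleC :: complex \<Rightarrow> 'a \<Rightarrow> 'a::complex_vector"
  defines cspan = complex_vector.span
    and cdim = complex_vector.dim
  by unfold_locales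
    (simp_all add: scaleC_add_right scaleC_add_left scaleC_scaleC scaleC_one)

text \<open>The scalar product is antilinear in its first and linear in its second argument.
  Its positivity, and the norm \<open>sqrt (Re (cinner u u))\<close>, come from \<^class>\<open>real_inner\<close>.\<close>

class complex_inner = complex_vector + real_inner +
  fixes cinner :: "'a \<Rightarrow> 'a \<Rightarrow> complex"
  assumes cinner_commute: "cinner u v = cnj (cinner v u)"
    and cinner_add_right: "cinner u (v + w) = cinner u v + cinner u w"
    and cinner_scaleC_right: "cinner u (c *\<^sub>C v) = c * cinner u v"
    and inner_eq_Re_cinner: "inner u v = Re (cinner u v)"

class complex_hilbert = complex_inner + complete_space

definition hilbert_basis :: "'h::complex_hilbert set \<Rightarrow> bool" where
  "hilbert_basis B \<longleftrightarrow>
     (\<forall>e\<in>B. \<forall>f\<in>B. cinner e f = (if e = f then 1 else 0)) \<and> closure (cspan B) = UNIV"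

text \<open>For the finite-rank operators to which it is applied, the trace does not depend on the
  orthonormal basis that is picked.\<close>

definition hilbert_trace :: "('h::complex_hilbert \<Rightarrow> 'h) \<Rightarrow> complex" where
  "hilbert_trace T = (\<Sum>\<^sub>\<infinity>e\<in>(SOME B. hilbert_basis B). cinner e (T e))"

definition orth_proj :: "'h::complex_hilbert set \<Rightarrow> 'h \<Rightarrow> 'h" where
  "orth_proj V v = (THE w. w \<in> V \<and> (\<forall>u\<in>V. cinner u (v - w) = 0))"

definition gen_eigenspace :: "('h::complex_hilbert \<Rightarrow> 'h) \<Rightarrow> complex \<Rightarrow> 'h set" where
  "gen_eigenspace T z = {v. \<exists>k. ((\<lambda>w. T w - z *\<^sub>C w) ^^ k) v = 0}"

definition eigenvalues :: "('h::complex_hilbert \<Rightarrow> 'h) \<Rightarrow> complex set" where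
  "eigenvalues T = {z. \<exists>v. v \<noteq> 0 \<and> T v = z *\<^sub>C v}"

text \<open>The non-zero eigenvalues, each repeated according to its algebraic multiplicity. This is
  meaningful for operators of finite rank, where the index set of the sum is finite and so are the
  dimensions.\<close>

definition nonzero_eigenvalues :: "('h::complex_hilbert \<Rightarrow> 'h) \<Rightarrow> complex multiset" where
  "nonzero_eigenvalues T =
     (\<Sum>z\<in>eigenvalues T - {0}. replicate_mset (cdim (gen_eigenspace T z)) z)"


section \<open>Causal fermion systems\<close>

text \<open>The type \<open>'h \<Rightarrow>\<^sub>L 'h\<close> consists of the real-linear bounded operators, so complex linearity is
  required separately in \<open>fermion_ops\<close>. Its topology is the norm topology.\<close>

definition finite_rank :: "('h::complex_hilbert \<Rightarrow>\<^sub>L 'h) \<Rightarrow> bool" where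
  "finite_rank x \<longleftrightarrow> (\<exists>B. finite B \<and> range (blinfun_apply x) \<subseteq> cspan B)"

definition selfadjoint :: "('h::complex_hilbert \<Rightarrow>\<^sub>L 'h) \<Rightarrow> bool" where
  "selfadjoint x \<longleftrightarrow> (\<forall>u v. cinner (blinfun_apply x u) v = cinner u (blinfun_apply x v))"

definition num_pos_eigenvalues :: "('h::complex_hilbert \<Rightarrow>\<^sub>L 'h) \<Rightarrow> nat" where
  "num_pos_eigenvalues x = size {#z \<in># nonzero_eigenvalues (blinfun_apply x). z \<in> \<real> \<and> Re z > 0#}"

definition num_neg_eigenvalues :: "('h::complex_hilbert \<Rightarrow>\<^sub>L 'h) \<Rightarrow> nat" where
  "num_neg_eigenvalues x = size {#z \<in># nonzero_eigenvalues (blinfun_apply x). z \<in> \<real> \<and> Re z < 0#}"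

definition fermion_ops :: "nat \<Rightarrow> ('h::complex_hilbert \<Rightarrow>\<^sub>L 'h) set" where
  "fermion_ops n = {x. Vector_Spaces.linear (*\<^sub>C) (*\<^sub>C) (blinfun_apply x) \<and>
     selfadjoint x \<and> finite_rank x \<and> num_pos_eigenvalues x \<le> n \<and> num_neg_eigenvalues x \<le> n}"

definition causal_fermion_system :: "nat \<Rightarrow> ('h::complex_hilbert \<Rightarrow>\<^sub>L 'h) measure \<Rightarrow> bool" where
  "causal_fermion_system n \<rho> \<longleftrightarrow>
     separable_space (euclidean :: 'h topology) \<and>
     sets \<rho> = sets (restrict_space borel (fermion_ops n))"

definition regular_point :: "nat \<Rightarrow> ('h::complex_hilbert \<Rightarrow>\<^sub>L 'h) \<Rightarrow> bool" where
  "regular_point n x \<longleftrightarrow>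
     x \<in> fermion_ops n \<and> num_pos_eigenvalues x = n \<and> num_neg_eigenvalues x = n"

definition spin_space :: "('h::complex_hilbert \<Rightarrow>\<^sub>L 'h) \<Rightarrow> 'h set" where
  "spin_space x = range (blinfun_apply x)"

definition spin_inner :: "('h::complex_hilbert \<Rightarrow>\<^sub>L 'h) \<Rightarrow> 'h \<Rightarrow> 'h \<Rightarrow> complex" where
  "spin_inner x u v = cinner u (blinfun_apply x v)"

definition spin_proj :: "('h::complex_hilbert \<Rightarrow>\<^sub>L 'h) \<Rightarrow> 'h \<Rightarrow> 'h" where
  "spin_proj x = orth_proj (spin_space x)"

definition fermionic_projector ::
    "('h::complex_hilbert \<Rightarrow>\<^sub>L 'h) \<Rightarrow> ('h \<Rightarrow>\<^sub>L 'h) \<Rightarrow> 'h \<Rightarrow> 'h" where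
  "fermionic_projector x y = (\<lambda>v\<in>spin_space y. spin_proj x (blinfun_apply y v))"

definition closed_chain ::
    "('h::complex_hilbert \<Rightarrow>\<^sub>L 'h) \<Rightarrow> ('h \<Rightarrow>\<^sub>L 'h) \<Rightarrow> 'h \<Rightarrow> 'h" where
  "closed_chain x y =
     compose (spin_space x) (fermionic_projector x y) (fermionic_projector y x)"

definition causal_eigenvalues ::
    "nat \<Rightarrow> ('h::complex_hilbert \<Rightarrow>\<^sub>L 'h) \<Rightarrow> ('h \<Rightarrow>\<^sub>L 'h) \<Rightarrow> complex multiset" where
  "causal_eigenvalues n x y =
     (let E = nonzero_eigenvalues (blinfun_apply (x o\<^sub>L y))
      in E + replicate_mset (2 * n - size E) 0)"

definition spacelike :: "nat \<Rightarrow> ('h::complex_hilbert \<Rightarrow>\<^sub>L 'h) \<Rightarrow> ('h \<Rightarrow>\<^sub>L 'h) \<Rightarrow> bool" where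
  "spacelike n x y \<longleftrightarrow>
     (\<forall>z \<in># causal_eigenvalues n x y. \<forall>w \<in># causal_eigenvalues n x y. cmod z = cmod w)"

definition lagrangian :: "nat \<Rightarrow> ('h::complex_hilbert \<Rightarrow>\<^sub>L 'h) \<Rightarrow> ('h \<Rightarrow>\<^sub>L 'h) \<Rightarrow> real" where
  "lagrangian n x y = 1 / (4 * real n) *
     (\<Sum>z \<in># causal_eigenvalues n x y. \<Sum>w \<in># causal_eigenvalues n x y. (cmod z - cmod w)\<^sup>2)"

definition causal_correlation ::
    "nat \<Rightarrow> ('h::complex_hilbert \<Rightarrow>\<^sub>L 'h) \<Rightarrow> ('h \<Rightarrow>\<^sub>L 'h) \<Rightarrow> 'h \<Rightarrow> 'h" where
  "causal_correlation n x y =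
     (if spacelike n x y then (\<lambda>v. 0) else closed_chain x y \<circ> spin_proj x)"

definition expectation_total :: "nat \<Rightarrow> ('h::complex_hilbert \<Rightarrow> 'h) \<Rightarrow> complex" where
  "expectation_total n T = hilbert_trace T / (2 * of_nat n)"

definition variance_total ::
    "nat \<Rightarrow> ('h::complex_hilbert \<Rightarrow>\<^sub>L 'h) \<Rightarrow> ('h \<Rightarrow> 'h) \<Rightarrow> complex" where
  "variance_total n x T =
     expectation_total n ((\<lambda>v. T v - expectation_total n T *\<^sub>C spin_proj x v) ^^ 2)"


section \<open>Dirac spinors\<close>

text \<open>Matrix rows and columns are listed at the positions 1, 2, 3, 4 of the index type \<^typ>\<open>4\<close>,
  whereas the Lorentz indices are named 0, 1, 2, 3. In this type \<open>4 = 0\<close>, and the two kinds of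
  indices are unrelated.\<close>

definition dirac_gamma :: "4 \<Rightarrow> complex^4^4" where
  "dirac_gamma \<mu> =
    (if \<mu> = 0 then vector [vector [1, 0, 0, 0],
                           vector [0, 1, 0, 0],
                           vector [0, 0, -1, 0],
                           vector [0, 0, 0, -1]]
     else if \<mu> = 1 then vector [vector [0, 0, 0, 1],
                                vector [0, 0, 1, 0],
                                vector [0, -1, 0, 0],
                                vector [-1, 0, 0, 0]]
     else if \<mu> = 2 then vector [vector [0, 0, 0, -\<i>],
                                vector [0, 0, \<i>, 0],
                                vector [0, \<i>, 0, 0],
                                vector [-\<i>, 0, 0, 0]]
     else vector [vector [0, 0, 1, 0],
                  vector [0, 0, 0, -1],
                  vector [-1, 0, 0, 0],
                  vector [0, 1, 0, 0]])"

definition minkowski :: "4 \<Rightarrow> 4 \<Rightarrow> complex" where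
  "minkowski \<mu> \<nu> = (if \<mu> = \<nu> then if \<mu> = 0 then 1 else -1 else 0)"

lemma vector_4:
  "(vector [a, b, c, d] :: 'a::zero^4) $ 1 = a" "(vector [a, b, c, d] :: 'a^4) $ 2 = b"
  "(vector [a, b, c, d] :: 'a^4) $ 3 = c" "(vector [a, b, c, d] :: 'a^4) $ 4 = d"
  "(vector [a, b, c, d] :: 'a^4) $ 0 = d"
  unfolding vector_def by simp_all

lemma dirac_gamma_anticommute:
  "dirac_gamma \<mu> ** dirac_gamma \<nu> + dirac_gamma \<nu> ** dirac_gamma \<mu> = mat (2 * minkowski \<mu> \<nu>)"
  using exhaust_4[of \<mu>] exhaust_4[of \<nu>]
  by (auto simp: dirac_gamma_def minkowski_def vec_eq_iff forall_4 sum_4 matrix_matrix_mult_def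
      mat_def vector_4)

lemma dirac_gamma_adjoint:
  "(\<chi> i j. cnj (dirac_gamma \<mu> $ j $ i)) = dirac_gamma 0 ** dirac_gamma \<mu> ** dirac_gamma 0"
  using exhaust_4[of \<mu>]
  by (auto simp: dirac_gamma_def vec_eq_iff forall_4 sum_4 matrix_matrix_mult_def vector_4)

text \<open>\<open>dirac_slash \<xi> = \<xi>\<^sub>\<mu> \<gamma>\<^sup>\<mu>\<close> with \<open>\<xi>\<^sub>\<mu> = \<eta>\<^sub>\<mu>\<^sub>\<nu> \<xi>\<^sup>\<nu>\<close>; note that \<open>mat c\<close> is the scalar matrix \<open>c \<one>\<close>.\<close>

definition dirac_slash :: "complex^4 \<Rightarrow> complex^4^4" where
  "dirac_slash \<xi> = (\<Sum>\<mu>\<in>UNIV. mat (\<Sum>\<nu>\<in>UNIV. minkowski \<mu> \<nu> * \<xi> $ \<nu>) ** dirac_gamma \<mu>)"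

definition dirac_inner :: "complex^4 \<Rightarrow> complex^4 \<Rightarrow> complex" where
  "dirac_inner \<psi> \<phi> = - (\<Sum>i\<in>UNIV. cnj (\<psi> $ i) * (dirac_gamma 0 *v \<phi>) $ i)"

definition spinor_identification ::
    "('h::complex_hilbert \<Rightarrow>\<^sub>L 'h) \<Rightarrow> (complex^4 \<Rightarrow> 'h) \<Rightarrow> bool" where
  "spinor_identification x U \<longleftrightarrow>
     Vector_Spaces.linear (*s) (*\<^sub>C) U \<and> bij_betw U UNIV (spin_space x) \<and>
     (\<forall>\<psi> \<phi>. spin_inner x (U \<psi>) (U \<phi>) = dirac_inner \<psi> \<phi>)"

end

theory Submission
  imports Defs
begin

text \<open>In the chart of \<open>S\<^sub>x\<close> the closed chain is the matrix \<open>B = M M\<^sup>*\<close> with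
  \<open>M = a + \<beta>\<close>, \<open>a = \<i> \<alpha> \<xi>\<^sub>\<mu> \<gamma>\<^sup>\<mu>\<close>. Put \<open>c = tr B / 4\<close>, which is real. The Clifford
  relations make \<open>(B - c)\<^sup>2\<close> a real scalar \<open>D\<close> with \<open>c\<^sup>2 - D = \<bar>\<beta>\<^sup>2 - a\<^sup>2\<bar>\<^sup>2 \<ge> 0\<close>; so the
  eigenvalues are \<open>c \<plusminus> \<surd>D\<close>, each of multiplicity two by the trace. For \<open>D \<le> 0\<close> their moduli
  agree, the points are spacelike separated and both sides vanish. For \<open>D > 0\<close> the eigenvalues are
  real and their product \<open>c\<^sup>2 - D\<close> is non-negative, so the difference of their moduli squares to
  \<open>4 D\<close>, while \<open>D\<close> is the variance.\<close>

subsection \<open>Orthonormal families and the trace\<close>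

lemma cinner_add_left: "cinner (u + v) w = cinner u w + cinner v w"
  by (metis cinner_add_right cinner_commute complex_cnj_add)

lemma cinner_scaleC_left: "cinner (c *\<^sub>C u) v = cnj c * cinner u v"
  by (metis cinner_commute cinner_scaleC_right complex_cnj_mult)

lemma cinner_zero_right [simp]: "cinner u 0 = 0"
  using cinner_add_right[of u 0 0] by simp

lemma cinner_zero_left [simp]: "cinner 0 u = 0"
  using cinner_add_left[of 0 0 u] by simp

lemma cinner_diff_right: "cinner u (v - w) = cinner u v - cinner u w"
  using cinner_add_right[of u "v - w" w] by simp

lemma cinner_sum_right: "cinner u (\<Sum>i\<in>I. f i) = (\<Sum>i\<in>I. cinner u (f i))"
  by (induction I rule: infinite_finite_induct) (simp_all add: cinner_add_right)

lemma cinner_self: "cinner u u = complex_of_real ((norm u)\<^sup>2)"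
proof (rule complex_eqI)
  show "Re (cinner u u) = Re (complex_of_real ((norm u)\<^sup>2))"
    by (simp add: inner_eq_Re_cinner[symmetric] power2_norm_eq_inner)
  have "Im (cinner u u) = - Im (cinner u u)"
    by (subst cinner_commute) simp
  then show "Im (cinner u u) = Im (complex_of_real ((norm u)\<^sup>2))" by simp
qed

lemma cinner_self_eq_0_iff [simp]: "cinner u u = 0 \<longleftrightarrow> u = 0"
  by (simp add: cinner_self)

lemma norm_scaleC: "norm (c *\<^sub>C u) = cmod c * norm (u::'a::complex_inner)"
proof -
  have "cinner (c *\<^sub>C u) (c *\<^sub>C u) = (c * cnj c) * cinner u u"
    by (simp only: cinner_scaleC_left cinner_scaleC_right mult_ac)
  then have "complex_of_real ((norm (c *\<^sub>C u))\<^sup>2) = complex_of_real ((cmod c * norm u)\<^sup>2)"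
    by (simp add: cinner_self power_mult_distrib flip: complex_norm_square)
  then show ?thesis
    by (metis mult_nonneg_nonneg norm_ge_zero of_real_eq_iff power2_eq_imp_eq)
qed

lemma norm_cinner_le: "cmod (cinner u v) \<le> norm u * norm v"
proof -
  \<comment> \<open>This phase turns \<open>cinner u v\<close> into its modulus and so reduces the
    claim to the real Cauchy-Schwarz inequality. Since \<open>sgn 0 = 0\<close>, only
    \<open>cmod c \<le> 1\<close> holds in general.\<close>
  define c where "c = cnj (sgn (cinner u v))"
  have "cmod c \<le> 1" by (simp add: c_def norm_sgn)
  have "cinner u (c *\<^sub>C v) = complex_of_real (cmod (cinner u v))"
    by (cases "cinner u v = 0")
      (simp_all add: cinner_scaleC_right c_def sgn_eq complex_norm_square[symmetric] mult.commute
        power2_eq_square flip: complex_norm_square)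
  then have "cmod (cinner u v) = inner u (c *\<^sub>C v)"
    by (simp add: inner_eq_Re_cinner)
  also have "\<dots> \<le> norm u * norm (c *\<^sub>C v)"
    by (rule norm_cauchy_schwarz)
  also have "\<dots> \<le> norm u * norm v"
    using \<open>cmod c \<le> 1\<close> by (simp add: norm_scaleC mult_left_mono mult_left_le_one_le)
  finally show ?thesis .
qed

definition orthonormal :: "'h::complex_inner set \<Rightarrow> bool" where
  "orthonormal B \<longleftrightarrow> (\<forall>e\<in>B. \<forall>f\<in>B. cinner e f = (if e = f then 1 else 0))"

text \<open>For a finite orthonormal \<open>F\<close> this is the orthogonal projection of
  \<open>v\<close> onto the span of \<open>F\<close>.\<close>

definition fourier_sum :: "'h::complex_inner set \<Rightarrow> 'h \<Rightarrow> 'h" where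
  "fourier_sum F v = (\<Sum>e\<in>F. cinner e v *\<^sub>C e)"

lemma fourier_sum_in_span: "fourier_sum F v \<in> cspan F"
  unfolding fourier_sum_def
  by (intro complex_vector.span_sum complex_vector.span_scale complex_vector.span_base)

lemma cinner_fourier_sum:
  assumes "orthonormal F" "finite F" "u \<in> cspan F"
  shows "cinner u (fourier_sum F v) = cinner u v"
  using assms(3)
proof (induction rule: complex_vector.span_induct_alt)
  case base
  show ?case by simp
next
  case (step c e w)
  have "cinner e (fourier_sum F v) = (\<Sum>f\<in>F. cinner f v * cinner e f)"
    by (simp add: fourier_sum_def cinner_sum_right cinner_scaleC_right)
  also have "\<dots> = (\<Sum>f\<in>F. if f = e then cinner f v else 0)"
    using assms(1) step by (intro sum.cong) (auto simp: orthonormal_def)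
  also have "\<dots> = cinner e v"
    using assms(2) step by simp
  finally show ?case
    using step by (simp add: cinner_add_left cinner_scaleC_left)
qed

text \<open>Best approximation: the error \<open>v - ?p\<close> is orthogonal to
  \<open>?p - u\<close>, which lies in the span, so Pythagoras applies.\<close>

lemma norm_diff_fourier_sum_le:
  assumes "orthonormal F" "finite F" "u \<in> cspan F"
  shows "norm (v - fourier_sum F v) \<le> norm (v - u)"
proof -
  let ?p = "fourier_sum F v"
  have "?p - u \<in> cspan F"
    using assms(3) fourier_sum_in_span by (rule complex_vector.span_diff[rotated])
  then have "cinner (?p - u) (v - ?p) = 0"
    using cinner_fourier_sum[OF assms(1,2)] by (simp add: cinner_diff_right)
  then have "inner (v - ?p) (?p - u) = 0"
    by (subst inner_commute) (simp add: inner_eq_Re_cinner)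
  then have "(norm ((v - ?p) + (?p - u)))\<^sup>2 = (norm (v - ?p))\<^sup>2 + (norm (?p - u))\<^sup>2"
    by (intro norm_add_Pythagorean) (simp add: orthogonal_def)
  then have "(norm (v - ?p))\<^sup>2 \<le> (norm (v - u))\<^sup>2"
    by simp
  then show ?thesis by (rule power2_le_imp_le) simp
qed

text \<open>By density some \<open>u\<close> in the span of a finite \<open>G\<close> is close to
  \<open>v\<close>. For every larger finite \<open>F\<close> the Fourier sum is at least as close as
  \<open>u\<close>, which is convergence along the finite subsets.\<close>

lemma fourier_sum_tendsto:
  assumes "orthonormal B" "closure (cspan B) = UNIV"
  shows "((\<lambda>F. fourier_sum F v) \<longlongrightarrow> v) (finite_subsets_at_top B)"
proof (rule tendstoI)
  fix e :: real assume "e > 0"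
  obtain u where u: "u \<in> cspan B" "dist u v < e"
    using assms(2) \<open>e > 0\<close> by (metis UNIV_I closure_approachable)
  obtain G r where "finite G" "G \<subseteq> B" "u = (\<Sum>a\<in>G. r a *\<^sub>C a)"
    using u(1) unfolding complex_vector.span_explicit by blast
  then have uG: "u \<in> cspan G"
    by (simp add: complex_vector.span_sum complex_vector.span_scale complex_vector.span_base)
  have "dist (fourier_sum F v) v < e" if F: "finite F" "G \<subseteq> F" "F \<subseteq> B" for F
  proof -
    have "orthonormal F" using assms(1) F(3) unfolding orthonormal_def by blast
    moreover have "u \<in> cspan F"
      using uG F(2) complex_vector.span_mono by blast
    ultimately have "norm (v - fourier_sum F v) \<le> norm (v - u)"
      using F(1) norm_diff_fourier_sum_le by blast
    with u(2) show ?thesis by (simp add: dist_norm norm_minus_commute)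
  qed
  with \<open>finite G\<close> \<open>G \<subseteq> B\<close>
  show "\<forall>\<^sub>F F in finite_subsets_at_top B. dist (fourier_sum F v) v < e"
    unfolding eventually_finite_subsets_at_top by blast
qed

text \<open>The continuous functional \<open>cinner u\<close> is applied to the Fourier expansion of
  \<open>v\<close>.\<close>

lemma parseval_has_sum:
  assumes "hilbert_basis B"
  shows "((\<lambda>e. cinner u e * cinner e v) has_sum cinner u v) B"
proof -
  have on: "orthonormal B" and cl: "closure (cspan B) = UNIV"
    using assms by (auto simp: hilbert_basis_def orthonormal_def)
  have "bounded_linear (cinner u)"
    by (rule bounded_linear_intro[where K = "norm u"])
      (simp_all add: cinner_add_right scaleR_scaleC cinner_scaleC_right scaleR_conv_of_real
        norm_cinner_le mult.commute[of _ "norm u"])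
  from bounded_linear.tendsto[OF this fourier_sum_tendsto[OF on cl]]
  show ?thesis
    unfolding has_sum_def fourier_sum_def
    by (simp add: cinner_sum_right cinner_scaleC_right mult.commute)
qed

section \<open>Gram-Schmidt orthonormalization and existence of a Hilbert basis\<close>

fun gram_schmidt :: "(nat \<Rightarrow> 'h::complex_inner) \<Rightarrow> nat \<Rightarrow> 'h set" where
  "gram_schmidt d 0 = {}"
| "gram_schmidt d (Suc n) =
    (let F = gram_schmidt d n; w = d n - fourier_sum F (d n)
     in if w = 0 then F else insert (inverse (norm w) *\<^sub>R w) F)"

lemma gram_schmidt:
  "finite (gram_schmidt d n) \<and> orthonormal (gram_schmidt d n)"
proof (induction n)
  case 0
  show ?case by (simp add: orthonormal_def)
next
  case (Suc n)
  define F where "F = gram_schmidt d n"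
  define w where "w = d n - fourier_sum F (d n)"
  have F: "finite F" "orthonormal F" using Suc by (simp_all add: F_def)
  show ?case
  proof (cases "w = 0")
    case True
    then have "gram_schmidt d (Suc n) = F" by (simp add: Let_def w_def F_def)
    then show ?thesis using F by simp
  next
    case False
    define e where "e = inverse (norm w) *\<^sub>R w"
    have "cinner e e = 1"
      using False by (simp add: e_def cinner_self)
    moreover have right: "cinner f e = 0" if "f \<in> F" for f
      using cinner_fourier_sum[OF F(2,1) complex_vector.span_base[OF that]]
      by (simp add: e_def scaleR_scaleC cinner_scaleC_right w_def cinner_diff_right)
    moreover have "cinner e f = 0" if "f \<in> F" for f
      using right[OF that] by (subst cinner_commute) simp
    ultimately have "orthonormal (insert e F)"
      using F(2) unfolding orthonormal_def by (metis insert_iff zero_neq_one)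
    moreover have "gram_schmidt d (Suc n) = insert e F"
      using False by (simp add: Let_def e_def w_def F_def)
    ultimately show ?thesis using F by simp
  qed
qed

lemma gram_schmidt_span: "d n \<in> cspan (gram_schmidt d (Suc n))"
proof -
  define F where "F = gram_schmidt d n"
  define w where "w = d n - fourier_sum F (d n)"
  have d: "d n = fourier_sum F (d n) + w" by (simp add: w_def)
  show ?thesis
  proof (cases "w = 0")
    case True
    then have "gram_schmidt d (Suc n) = F" by (simp add: Let_def w_def F_def)
    then show ?thesis using d True fourier_sum_in_span[of F "d n"] by simp
  next
    case False
    define e where "e = inverse (norm w) *\<^sub>R w"
    have w: "w = complex_of_real (norm w) *\<^sub>C e"
      using False by (simp add: e_def flip: scaleR_scaleC)
    have "fourier_sum F (d n) \<in> cspan (insert e F)"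
      using fourier_sum_in_span[of F "d n"] complex_vector.span_mono[of F "insert e F"] by auto
    then have "fourier_sum F (d n) + complex_of_real (norm w) *\<^sub>C e \<in> cspan (insert e F)"
      by (simp add: complex_vector.span_add complex_vector.span_scale complex_vector.span_base)
    then have "d n \<in> cspan (insert e F)"
      using d w by metis
    moreover have "gram_schmidt d (Suc n) = insert e F"
      using False by (simp add: Let_def e_def w_def F_def)
    ultimately show ?thesis by simp
  qed
qed

text \<open>An enumeration of a countable dense set is orthonormalized. Vectors already in the span
  of their predecessors are skipped, so repetitions and linear dependence do no harm. The stages are
  nested, hence any two members of the union share a stage.\<close>

lemma exists_hilbert_basis:
  assumes "separable_space (euclidean :: 'h::complex_hilbert topology)"
  shows "\<exists>B :: 'h set. hilbert_basis B"
proof -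
  obtain C :: "'h set" where C: "countable C" "closure C = UNIV"
    using assms by (auto simp: separable_space_def)
  then have "C \<noteq> {}" by auto
  define d where "d = from_nat_into C"
  define B where "B = (\<Union>n. gram_schmidt d n)"
  have mono: "gram_schmidt d m \<subseteq> gram_schmidt d n" if "m \<le> n" for m n
    using that
  proof (induction rule: dec_induct)
    case (step k)
    then show ?case by (auto simp: Let_def)
  qed simp
  have "orthonormal B"
    unfolding orthonormal_def
  proof (intro ballI)
    fix e f assume "e \<in> B" "f \<in> B"
    then obtain m n where "e \<in> gram_schmidt d m" "f \<in> gram_schmidt d n"
      by (auto simp: B_def)
    then have "e \<in> gram_schmidt d (max m n)" "f \<in> gram_schmidt d (max m n)"
      using mono max.cobounded1 max.cobounded2 by blast+
    then show "cinner e f = (if e = f then 1 else 0)"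
      using gram_schmidt[of d "max m n"] unfolding orthonormal_def by blast
  qed
  moreover have "C \<subseteq> cspan B"
  proof
    fix u assume "u \<in> C"
    then obtain n where "u = d n"
      using from_nat_into_surj[OF C(1)] by (metis d_def)
    then show "u \<in> cspan B"
      using gram_schmidt_span[of d n] complex_vector.span_mono[of "gram_schmidt d (Suc n)" B]
      unfolding B_def by blast
  qed
  then have "closure (cspan B) = UNIV"
    using C(2) closure_mono[of C "cspan B"] by auto
  ultimately have "hilbert_basis B"
    by (simp add: hilbert_basis_def orthonormal_def)
  then show ?thesis ..
qed

text \<open>Separability makes the choice in \<open>hilbert_trace\<close> pick a genuine basis.
  Parseval then evaluates each rank-one summand, with a value that does not depend on that
  basis.\<close>

lemma hilbert_trace_finite_rank:
  fixes a b :: "'i \<Rightarrow> 'h::complex_hilbert"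
  assumes "separable_space (euclidean :: 'h topology)"
  shows "hilbert_trace (\<lambda>v. \<Sum>i\<in>I. cinner (a i) v *\<^sub>C b i) = (\<Sum>i\<in>I. cinner (a i) (b i))"
proof -
  define B :: "'h set" where "B = (SOME B. hilbert_basis B)"
  have "hilbert_basis B"
    unfolding B_def using exists_hilbert_basis[OF assms] by (rule someI_ex)
  then have "((\<lambda>e. \<Sum>i\<in>I. cinner (a i) e * cinner e (b i)) has_sum (\<Sum>i\<in>I. cinner (a i) (b i))) B"
    by (induction I rule: infinite_finite_induct) (simp_all add: has_sum_add parseval_has_sum)
  then show ?thesis
    unfolding hilbert_trace_def B_def[symmetric]
    by (simp add: cinner_sum_right cinner_scaleC_right infsumI)
qed

subsection \<open>Coordinates on a spin space\<close>

lemma dirac_gamma_0_vector [simp]: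
  "dirac_gamma 0 *v \<psi> = vector [\<psi> $ 1, \<psi> $ 2, - \<psi> $ 3, - \<psi> $ 4]"
  by (simp add: vec_eq_iff forall_4 dirac_gamma_def matrix_vector_mult_def sum_4 vector_4)

lemma dirac_inner_expand:
  "dirac_inner \<psi> \<phi> = - cnj (\<psi> $ 1) * \<phi> $ 1 - cnj (\<psi> $ 2) * \<phi> $ 2
    + cnj (\<psi> $ 3) * \<phi> $ 3 + cnj (\<psi> $ 4) * \<phi> $ 4"
  by (simp add: dirac_inner_def sum_4 vector_4)

locale spinor_chart =
  fixes n :: nat and x :: "'h::complex_hilbert \<Rightarrow>\<^sub>L 'h" and U :: "complex^4 \<Rightarrow> 'h"
  assumes x: "x \<in> fermion_ops n"
    and U: "spinor_identification x U"
begin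

abbreviation X :: "'h \<Rightarrow> 'h" where "X \<equiv> blinfun_apply x"

sublocale X: Vector_Spaces.linear "(*\<^sub>C)" "(*\<^sub>C)" X
  using x by (simp add: fermion_ops_def)

sublocale U: Vector_Spaces.linear "(*s)" "(*\<^sub>C)" U
  using U by (simp add: spinor_identification_def)

lemma cinner_X: "cinner (X u) v = cinner u (X v)"
  using x by (simp add: fermion_ops_def selfadjoint_def)

lemma range_U: "range U = range X"
  using U by (simp add: spinor_identification_def bij_betw_def spin_space_def)

lemma inj_U: "inj U"
  using U by (simp add: spinor_identification_def bij_betw_def)

lemma U_in_spin_space [simp]: "U \<psi> \<in> spin_space x"
  using range_U by (auto simp: spin_space_def)

lemma cinner_U_X_U: "cinner (U \<psi>) (X (U \<phi>)) = dirac_inner \<psi> \<phi>"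
  using U by (simp add: spinor_identification_def spin_inner_def)

text \<open>The Gram matrix of the \<open>U (axis k 1)\<close> is \<open>-\<gamma>\<^sup>0\<close>, its own inverse; so \<open>U \<circ> coord\<close> is the
  orthogonal projection.\<close>

definition coord :: "'h \<Rightarrow> complex^4" where
  "coord v = - (dirac_gamma 0 *v (\<chi> k. cinner (U (axis k 1)) (X v)))"

text \<open>This property characterizes \<open>coord v\<close>: the Dirac product with it represents
  the functional given by \<open>X v\<close> on the spin space.\<close>

lemma dirac_inner_coord: "dirac_inner \<psi> (coord v) = cinner (U \<psi>) (X v)"
proof -
  have "U \<psi> = U (\<Sum>k\<in>UNIV. \<psi> $ k *s axis k 1)"
    by (simp add: basis_expansion)
  also have "\<dots> = (\<Sum>k\<in>UNIV. \<psi> $ k *\<^sub>C U (axis k 1))"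
    by (simp add: U.sum U.scale)
  finally show ?thesis
    by (simp add: cinner_add_left cinner_scaleC_left sum_4 dirac_inner_expand coord_def vector_4)
qed

text \<open>Non-degeneracy of the Dirac product, tested on the axis vectors.\<close>

lemma coord_unique:
  assumes "\<And>\<phi>. cinner (U \<phi>) (X v) = dirac_inner \<phi> \<psi>"
  shows "coord v = \<psi>"
  by (simp add: coord_def assms dirac_inner_expand vec_eq_iff forall_4 axis_def vector_4)

lemma coord_U [simp]: "coord (U \<psi>) = \<psi>"
  by (rule coord_unique) (rule cinner_U_X_U)

text \<open>The vector \<open>X ?d\<close> is orthogonal to the range of \<open>U\<close>, but lies
  in that range itself, so it vanishes.\<close>

lemma X_U_coord: "X (U (coord v)) = X v"
proof -
  let ?d = "U (coord v) - v"
  have "cinner (U \<psi>) (X ?d) = 0" for \<psi>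
    by (simp add: X.diff cinner_diff_right cinner_U_X_U dirac_inner_coord)
  moreover obtain \<psi> where "X ?d = U \<psi>"
    using range_U by (metis rangeE rangeI)
  ultimately have "cinner (X ?d) (X ?d) = 0" by metis
  then show ?thesis by (simp add: X.diff)
qed

text \<open>By its definition \<open>coord v\<close> depends on \<open>v\<close> only through
  \<open>X v\<close>; so \<open>X (U \<psi>)\<close> determines
  \<open>coord (U \<psi>) = \<psi>\<close>.\<close>

lemma inj_X_U: "inj (\<lambda>\<psi>. X (U \<psi>))"
  by (rule injI) (metis X_U_coord coord_def coord_U)

lemma range_X_U: "range (\<lambda>\<psi>. X (U \<psi>)) = range X"
  by (auto simp: image_iff) (metis X_U_coord)

text \<open>As \<open>X\<close> is self-adjoint, a vector is orthogonal to the spin space iff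
  \<open>X\<close> annihilates it. Thus \<open>X_U_coord\<close> yields existence and
  \<open>coord_unique\<close> uniqueness of the projection.\<close>

lemma spin_proj_eq: "spin_proj x v = U (coord v)"
  unfolding spin_proj_def orth_proj_def
proof (rule the_equality)
  show "U (coord v) \<in> spin_space x \<and> (\<forall>u\<in>spin_space x. cinner u (v - U (coord v)) = 0)"
    using U_in_spin_space by (auto simp: spin_space_def cinner_X X.diff X_U_coord)
next
  fix w
  assume w: "w \<in> spin_space x \<and> (\<forall>u\<in>spin_space x. cinner u (v - w) = 0)"
  then obtain \<psi> where \<psi>: "w = U \<psi>"
    using range_U by (auto simp: spin_space_def)
  have "cinner (U \<phi>) (X v) = dirac_inner \<phi> \<psi>" for \<phi>
  proof -
    have "cinner (X (U \<phi>)) (v - w) = 0"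
      using w by (simp add: spin_space_def)
    then show ?thesis
      by (simp add: cinner_X X.diff cinner_diff_right \<psi> cinner_U_X_U)
  qed
  then show "w = U (coord v)"
    using \<psi> coord_unique by simp
qed

text \<open>The operator acts as \<open>N\<close> in the chart and vanishes on the orthogonal
  complement of the spin space; \<open>mat 1\<close> yields the projection
  \<open>spin_proj x\<close>.\<close>

definition lift_matrix :: "complex^4^4 \<Rightarrow> 'h \<Rightarrow> 'h" where
  "lift_matrix N v = U (N *v coord v)"

lemma lift_matrix_comp: "lift_matrix N (lift_matrix N' v) = lift_matrix (N ** N') v"
  by (simp add: lift_matrix_def matrix_vector_mul_assoc)

lemma hilbert_trace_lift_matrix:
  assumes "separable_space (euclidean :: 'h topology)"
  shows "hilbert_trace (lift_matrix N) = trace N"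
proof -
  \<comment> \<open>The family dual to \<open>U (axis k 1)\<close>; the signs are the diagonal
    entries of \<open>-\<gamma>\<^sup>0\<close>.\<close>
  define a where "a k = (if k = 1 \<or> k = 2 then - 1 else 1) *\<^sub>C X (U (axis k 1))" for k :: 4
  have a: "cinner (a k) v = coord v $ k" for k v
    using exhaust_4[of k]
    by (auto simp: a_def cinner_scaleC_left cinner_X coord_def vector_4)
  have "lift_matrix N v = (\<Sum>k\<in>UNIV. cinner (a k) v *\<^sub>C U (N *v axis k 1))" for v
  proof -
    have "lift_matrix N v = U (N *v (\<Sum>k\<in>UNIV. coord v $ k *s axis k 1))"
      by (simp add: lift_matrix_def basis_expansion)
    also have "\<dots> = (\<Sum>k\<in>UNIV. coord v $ k *\<^sub>C U (N *v axis k 1))"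
      by (simp add: U.sum U.scale vec.sum vec.scale)
    finally show ?thesis by (simp add: a)
  qed
  then have "lift_matrix N = (\<lambda>v. \<Sum>k\<in>UNIV. cinner (a k) v *\<^sub>C U (N *v axis k 1))" ..
  then have "hilbert_trace (lift_matrix N) = (\<Sum>k\<in>UNIV. cinner (a k) (U (N *v axis k 1)))"
    by (simp add: hilbert_trace_finite_rank[OF assms])
  also have "\<dots> = trace N"
    by (simp add: a trace_def matrix_vector_mult_def axis_def if_distrib cong: if_cong)
  finally show ?thesis .
qed

end

subsection \<open>Clifford algebra\<close>

lemma mat_mult_vector [simp]: "mat (c::'a::comm_semiring_1) *v v = c *s v"
  by (simp add: matrix_vector_mult_def mat_def vec_eq_iff if_distrib if_distribR cong: if_cong)

lemma mat_mult_nth: "(mat c ** A) $ i $ j = c * (A $ i $ j :: 'a::comm_semiring_1)"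
proof -
  have "(mat c ** A) $ i $ j = (\<Sum>k\<in>UNIV. if i = k then c * A $ i $ j else 0)"
    unfolding matrix_matrix_mult_def mat_def vec_lambda_beta by (rule sum.cong) auto
  then show ?thesis by simp
qed

lemma trace_mat: "trace (mat c :: 'a::comm_semiring_1^'n^'n) = of_nat CARD('n) * c"
  by (simp add: trace_def mat_def)

definition minkowski_inner :: "complex^4 \<Rightarrow> complex^4 \<Rightarrow> complex" where
  "minkowski_inner p q = p $ 0 * q $ 0 - p $ 1 * q $ 1 - p $ 2 * q $ 2 - p $ 3 * q $ 3"

definition cnj_vec :: "complex^'n \<Rightarrow> complex^'n" where
  "cnj_vec p = (\<chi> i. cnj (p $ i))"

lemma cnj_vec_nth [simp]: "cnj_vec p $ i = cnj (p $ i)"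
  by (simp add: cnj_vec_def)

lemma dirac_slash_eq:
  "dirac_slash p =
    vector [vector [p $ 0, 0, - p $ 3, - p $ 1 + \<i> * p $ 2],
            vector [0, p $ 0, - p $ 1 - \<i> * p $ 2, p $ 3],
            vector [p $ 3, p $ 1 - \<i> * p $ 2, - p $ 0, 0],
            vector [p $ 1 + \<i> * p $ 2, - p $ 3, 0, - p $ 0]]"
proof -
  have mink: "(\<Sum>\<nu>\<in>UNIV. minkowski \<mu> \<nu> * p $ \<nu>) = (if \<mu> = 0 then p $ 0 else - p $ \<mu>)" for \<mu>
  proof -
    have "(\<Sum>\<nu>\<in>UNIV. minkowski \<mu> \<nu> * p $ \<nu>) =
        (\<Sum>\<nu>\<in>UNIV. if \<mu> = \<nu> then minkowski \<mu> \<mu> * p $ \<mu> else 0)"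
      by (rule sum.cong) (auto simp: minkowski_def)
    then show ?thesis by (simp add: minkowski_def)
  qed
  have "dirac_slash p $ i $ j = p $ 0 * dirac_gamma 0 $ i $ j - p $ 1 * dirac_gamma 1 $ i $ j
      - p $ 2 * dirac_gamma 2 $ i $ j - p $ 3 * dirac_gamma 3 $ i $ j" for i j
  proof -
    \<comment> \<open>The sum over the index type runs through 1, 2, 3, 4, and its last index is the
      Lorentz index 0.\<close>
    have 4: "(4 :: 4) = 0" by simp
    show ?thesis
      unfolding dirac_slash_def mink sum_4 4 vector_add_component mat_mult_nth by simp
  qed
  then show ?thesis
    by (simp add: vec_eq_iff forall_4 dirac_gamma_def vector_4)
qed

lemma dirac_slash_nth:
  "(dirac_slash p *v \<psi>) $ 1 = p $ 0 * \<psi> $ 1 - p $ 3 * \<psi> $ 3 - (p $ 1 - \<i> * p $ 2) * \<psi> $ 4"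
  "(dirac_slash p *v \<psi>) $ 2 = p $ 0 * \<psi> $ 2 - (p $ 1 + \<i> * p $ 2) * \<psi> $ 3 + p $ 3 * \<psi> $ 4"
  "(dirac_slash p *v \<psi>) $ 3 = p $ 3 * \<psi> $ 1 + (p $ 1 - \<i> * p $ 2) * \<psi> $ 2 - p $ 0 * \<psi> $ 3"
  "(dirac_slash p *v \<psi>) $ 4 = (p $ 1 + \<i> * p $ 2) * \<psi> $ 1 - p $ 3 * \<psi> $ 2 - p $ 0 * \<psi> $ 4"
  by (simp_all add: matrix_vector_mult_def sum_4 dirac_slash_eq vector_4 algebra_simps)

lemma dirac_slash_scale: "mat c ** dirac_slash p = dirac_slash (c *s p)"
  unfolding matrix_eq
  by (simp add: vec_eq_iff forall_4 dirac_slash_nth algebra_simps flip: matrix_vector_mul_assoc)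

lemma dirac_slash_anticommute:
  "dirac_slash p *v (dirac_slash q *v v) =
    (2 * minkowski_inner p q) *s v - dirac_slash q *v (dirac_slash p *v v)"
  by (simp add: vec_eq_iff forall_4 dirac_slash_nth minkowski_inner_def algebra_simps)

lemma dirac_slash_square: "dirac_slash p *v (dirac_slash p *v v) = minkowski_inner p p *s v"
  by (simp add: vec_eq_iff forall_4 dirac_slash_nth minkowski_inner_def algebra_simps)

lemma trace_dirac_slash: "trace (dirac_slash p) = 0"
  by (simp add: trace_def sum_4 dirac_slash_eq vector_4)

lemma trace_dirac_slash_mult:
  "trace (dirac_slash p ** dirac_slash q) = 4 * minkowski_inner p q"
  by (simp add: trace_def sum_4 matrix_matrix_mult_def dirac_slash_eq vector_4 minkowski_inner_def
      algebra_simps)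

text \<open>Every Dirac matrix is symmetric for the Dirac product, so passing to the adjoint only
  conjugates the components of \<open>p\<close>.\<close>

lemma dirac_inner_slash:
  "dirac_inner (dirac_slash p *v \<psi>) \<phi> = dirac_inner \<psi> (dirac_slash (cnj_vec p) *v \<phi>)"
  by (simp add: dirac_inner_expand dirac_slash_nth algebra_simps)

lemma dirac_inner_adjoint:
  "dirac_inner ((dirac_slash p + mat \<beta>) *v \<psi>) \<phi> =
    dirac_inner \<psi> ((dirac_slash (cnj_vec p) + mat (cnj \<beta>)) *v \<phi>)"
proof -
  have "dirac_inner (\<psi> + \<psi>') \<phi> = dirac_inner \<psi> \<phi> + dirac_inner \<psi>' \<phi>"
    "dirac_inner \<psi> (\<phi> + \<phi>') = dirac_inner \<psi> \<phi> + dirac_inner \<psi> \<phi>'"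
    "dirac_inner (c *s \<psi>) \<phi> = dirac_inner \<psi> (cnj c *s \<phi>)" for c \<psi> \<psi>' \<phi> \<phi>'
    by (simp_all add: dirac_inner_expand algebra_simps)
  then show ?thesis
    by (simp add: matrix_vector_mult_add_rdistrib dirac_inner_slash)
qed

text \<open>Expanding gives \<open>N = (P Q - h) + (c P + b Q)\<close>. The relation
  \<open>P Q + Q P = 2 h\<close> makes \<open>P Q - h\<close> anticommute with both \<open>P\<close>
  and \<open>Q\<close>, so the mixed terms of the square cancel. The remaining squares are the
  scalars \<open>h^2 - A C\<close> and \<open>c^2 A + b^2 C + 2 b c h\<close>.\<close>

lemma clifford_square:
  fixes P Q :: "'a::comm_ring_1^'n^'n" and A C h b c :: 'a
  assumes PP: "\<And>v. P *v (P *v v) = A *s v"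
    and QQ: "\<And>v. Q *v (Q *v v) = C *s v"
    and QP: "\<And>v. Q *v (P *v v) = (2 * h) *s v - P *v (Q *v v)"
  defines "N \<equiv> (P + mat b) ** (Q + mat c) - mat (h + b * c)"
  shows "N ** N = mat (h\<^sup>2 - A * C + c\<^sup>2 * A + b\<^sup>2 * C + 2 * b * c * h)"
proof -
  have scale: "M *v (r *s v) = r *s (M *v v)" for M :: "'a^'n^'n" and r v
    by (simp add: matrix_vector_mult_def vec_eq_iff sum_distrib_left mult_ac)
  have diff: "M *v (v - w) = M *v v - M *v w" for M :: "'a^'n^'n" and v w
    by (simp add: matrix_vector_mult_def vec_eq_iff algebra_simps sum_subtractf)
  have N: "N *v v = P *v (Q *v v) + c *s (P *v v) + b *s (Q *v v) - h *s v" for v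
    by (simp add: N_def matrix_vector_mult_add_rdistrib matrix_vector_mult_diff_rdistrib
        matrix_vector_right_distrib scale vec_eq_iff algebra_simps flip: matrix_vector_mul_assoc)
  show ?thesis
    unfolding matrix_eq matrix_vector_mul_assoc[symmetric]
    by (simp add: N matrix_vector_right_distrib diff scale PP QQ QP
        vec_eq_iff algebra_simps power2_eq_square)
qed

lemma dirac_chain_quadratic:
  fixes p \<beta>
  defines "B \<equiv> (dirac_slash p + mat \<beta>) ** (dirac_slash (cnj_vec p) + mat (cnj \<beta>))"
  obtains c D :: real where "trace B = 4 * complex_of_real c"
    and "(B - mat (of_real c)) ** (B - mat (of_real c)) = mat (complex_of_real D)"
    and "D \<le> c\<^sup>2"
proof -
  let ?q = "cnj_vec p"
  define A where "A = minkowski_inner p p"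
  define h where "h = Re (minkowski_inner p ?q)"
  have A': "minkowski_inner ?q ?q = cnj A"
    by (simp add: A_def minkowski_inner_def)
  have h: "minkowski_inner p ?q = complex_of_real h"
    by (rule complex_eqI) (simp_all add: h_def minkowski_inner_def)
  define c where "c = h + (cmod \<beta>)\<^sup>2"
  \<comment> \<open>The scalar from \<open>clifford_square\<close> with \<open>b = \<beta>\<close>,
    \<open>c = cnj \<beta>\<close> and \<open>C = cnj A\<close>. Its two terms linear in
    \<open>A\<close> and \<open>cnj A\<close> are conjugate to each other and combine to twice a
    real part.\<close>
  define D where "D = h\<^sup>2 - (cmod A)\<^sup>2 + 2 * Re ((cnj \<beta>)\<^sup>2 * A) + 2 * (cmod \<beta>)\<^sup>2 * h"
  have c: "complex_of_real c = of_real h + \<beta> * cnj \<beta>"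
    using complex_norm_square[of \<beta>] by (simp add: c_def)
  show ?thesis
  proof
    have "trace B = trace (dirac_slash p ** dirac_slash ?q) + trace (dirac_slash (cnj \<beta> *s p))
        + trace (dirac_slash (\<beta> *s ?q)) + trace (mat (\<beta> * cnj \<beta>) :: complex^4^4)"
      unfolding trace_add[symmetric]
    proof (rule arg_cong[where f = trace])
      show "B = dirac_slash p ** dirac_slash ?q + dirac_slash (cnj \<beta> *s p)
          + dirac_slash (\<beta> *s ?q) + (mat (\<beta> * cnj \<beta>) :: complex^4^4)"
        unfolding matrix_eq B_def matrix_vector_mul_assoc[symmetric] dirac_slash_scale[symmetric]
          matrix_vector_mult_add_rdistrib matrix_vector_right_distrib mat_mult_vector vec.scale
        by (simp add: vec_eq_iff algebra_simps)
    qed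
    then show "trace B = 4 * complex_of_real c"
      by (simp add: trace_dirac_slash trace_dirac_slash_mult trace_mat h c)
    have square: "dirac_slash p *v (dirac_slash p *v v) = A *s v"
      "dirac_slash ?q *v (dirac_slash ?q *v v) = cnj A *s v" for v
      by (simp_all only: dirac_slash_square A' A_def)
    have "minkowski_inner ?q p = of_real h"
      by (simp add: minkowski_inner_def mult.commute flip: h)
    then have anti: "dirac_slash ?q *v (dirac_slash p *v v) =
        (2 * of_real h) *s v - dirac_slash p *v (dirac_slash ?q *v v)" for v
      by (subst dirac_slash_anticommute) simp
    have "cnj (cnj \<beta> ^ 2 * A) = \<beta>\<^sup>2 * cnj A" by simp
    then have "complex_of_real (2 * Re ((cnj \<beta>)\<^sup>2 * A)) = (cnj \<beta>)\<^sup>2 * A + \<beta>\<^sup>2 * cnj A"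
      by (metis complex_add_cnj)
    then have "complex_of_real D = (of_real h)\<^sup>2 - A * cnj A + (cnj \<beta>)\<^sup>2 * A + \<beta>\<^sup>2 * cnj A
        + 2 * \<beta> * cnj \<beta> * of_real h"
      using complex_norm_square[of \<beta>] complex_norm_square[of A]
      by (simp add: D_def algebra_simps)
    then show "(B - mat (of_real c)) ** (B - mat (of_real c)) = mat (complex_of_real D)"
      unfolding B_def c using clifford_square[OF square(1) square(2) anti, of \<beta> "cnj \<beta>"]
      by (simp only:)
    \<comment> \<open>The constant term of the quadratic polynomial annihilating the chain factors
      into a number times its conjugate, hence is non-negative.\<close>
    have "complex_of_real (c\<^sup>2 - D) = (\<beta>\<^sup>2 - A) * cnj (\<beta>\<^sup>2 - A)"
      using \<open>complex_of_real D = _\<close> by (simp add: c algebra_simps power2_eq_square)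
    then have "complex_of_real (c\<^sup>2 - D) = complex_of_real ((cmod (\<beta>\<^sup>2 - A))\<^sup>2)"
      by (simp only: complex_norm_square)
    then have "c\<^sup>2 - D = (cmod (\<beta>\<^sup>2 - A))\<^sup>2"
      by (simp only: of_real_eq_iff)
    then show "D \<le> c\<^sup>2"
      by (metis diff_ge_0_iff_ge zero_le_power2)
  qed
qed

subsection \<open>Eigenvalues\<close>

text \<open>The trace is computed by expanding the columns of \<open>Q\<close> in a basis
  \<open>S\<close> of its range. After exchanging the sums, each \<open>s\<close> in
  \<open>S\<close> contributes the coefficient of \<open>s\<close> in \<open>Q *v s = s\<close>,
  which is 1.\<close>

lemma trace_idempotent:
  fixes Q :: "'a::field^'n^'n"
  assumes "Q ** Q = Q"
  shows "trace Q = of_nat (vec.dim (range ((*v) Q)))"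
proof -
  obtain S where S: "S \<subseteq> range ((*v) Q)" "vec.independent S" "range ((*v) Q) \<subseteq> vec.span S"
    "card S = vec.dim (range ((*v) Q))"
    using vec.basis_exists by blast
  have "finite S" using S(2) vec.finiteI_independent by blast
  define r where "r = vec.representation S"
  have Qv: "Q *v v \<in> vec.span S" for v using S(3) by blast
  have QS: "Q *v s = s" if s: "s \<in> S" for s
  proof -
    obtain w where "s = Q *v w" using s S(1) by blast
    then show ?thesis by (simp add: matrix_vector_mul_assoc assms)
  qed
  have expand: "Q *v v = (\<Sum>s\<in>S. r (Q *v v) s *s s)" for v
    unfolding r_def using vec.sum_representation_eq[OF S(2) Qv \<open>finite S\<close> order_refl] by simp
  have "trace Q = (\<Sum>j\<in>UNIV. (Q *v axis j 1) $ j)"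
    by (simp add: trace_def matrix_vector_mult_def axis_def if_distrib cong: if_cong)
  also have "\<dots> = (\<Sum>j\<in>UNIV. \<Sum>s\<in>S. r (Q *v axis j 1) s * s $ j)"
    by (subst expand) simp
  also have "\<dots> = (\<Sum>s\<in>S. \<Sum>j\<in>UNIV. r (Q *v axis j 1) s * s $ j)"
    by (rule sum.swap)
  also have "\<dots> = (\<Sum>s\<in>S. 1)"
  proof (rule sum.cong[OF refl])
    fix s assume s: "s \<in> S"
    have "(\<Sum>j\<in>UNIV. r (Q *v axis j 1) s * s $ j) = (\<Sum>j\<in>UNIV. r (s $ j *s (Q *v axis j 1)) s)"
      unfolding r_def by (simp add: vec.representation_scale[OF S(2) Qv] mult.commute)
    also have "\<dots> = r (\<Sum>j\<in>UNIV. s $ j *s (Q *v axis j 1)) s"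
      unfolding r_def using Qv
      by (subst vec.representation_sum[OF S(2)]) (auto intro: vec.span_scale)
    also have "(\<Sum>j\<in>UNIV. s $ j *s (Q *v axis j 1)) = Q *v (\<Sum>j\<in>UNIV. s $ j *s axis j 1)"
      by (simp add: vec.sum vec.scale)
    also have "\<dots> = s"
      using QS[OF s] by (simp add: basis_expansion)
    also have "r s s = 1"
      unfolding r_def using vec.representation_basis[OF S(2) s] by simp
    finally show "(\<Sum>j\<in>UNIV. r (Q *v axis j 1) s * s $ j) = 1" .
  qed
  finally show ?thesis using S(4) by simp
qed

lemma cdim_linear_image:
  assumes "Vector_Spaces.linear (*s) (*\<^sub>C) V" "inj V"
  shows "cdim (V ` S) = vec.dim S"
proof -
  interpret V: Vector_Spaces.linear "(*s)" "(*\<^sub>C)" V by fact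
  obtain b where b: "b \<subseteq> S" "vec.independent b" "S \<subseteq> vec.span b" "card b = vec.dim S"
    using vec.basis_exists by blast
  have inj: "inj_on V A" for A using assms(2) inj_on_subset by blast
  show ?thesis
  proof (rule complex_vector.dim_unique)
    show "V ` b \<subseteq> V ` S" using b(1) by blast
    show "V ` S \<subseteq> cspan (V ` b)" using b(3) unfolding cspan_def V.span_image by blast
    show "\<not> complex_vector.dependent (V ` b)"
      using b(2) inj by (rule V.independent_injective_image)
    show "card (V ` b) = vec.dim S" using b(4) inj by (simp add: card_image)
  qed
qed

section \<open>Transfer of non-zero eigenvalues and their multiplicities along an injective
  intertwiner\<close>

definition matrix_gen_eigenspace :: "'a::comm_ring_1^'n^'n \<Rightarrow> 'a \<Rightarrow> ('a^'n) set" where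
  "matrix_gen_eigenspace B z = {\<psi>. \<exists>k. ((\<lambda>w. B *v w - z *s w) ^^ k) \<psi> = 0}"

text \<open>The map \<open>V\<close> is not onto in general. The inclusion \<open>range_T\<close>
  still confines all generalized eigenvectors with non-zero eigenvalue to the range of
  \<open>V\<close>, so \<open>B\<close> determines them.\<close>

locale matrix_intertwiner =
  fixes T :: "'h::complex_hilbert \<Rightarrow> 'h" and V :: "complex^'n \<Rightarrow> 'h" and B :: "complex^'n^'n"
  assumes V_linear: "Vector_Spaces.linear (*s) (*\<^sub>C) V"
    and V_inj: "inj V"
    and T_V: "T (V \<psi>) = V (B *v \<psi>)"
    and range_T: "range T \<subseteq> range V"
begin

sublocale V: Vector_Spaces.linear "(*s)" "(*\<^sub>C)" V
  by (rule V_linear)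

lemma funpow_T_V: "((\<lambda>w. T w - z *\<^sub>C w) ^^ k) (V \<psi>) = V (((\<lambda>w. B *v w - z *s w) ^^ k) \<psi>)"
  by (induction k) (simp_all add: T_V V.diff V.scale)

lemma in_range_V:
  assumes "z \<noteq> 0" "T v - z *\<^sub>C v \<in> range V"
  shows "v \<in> range V"
proof -
  obtain \<psi> \<phi> where "T v - z *\<^sub>C v = V \<psi>" "T v = V \<phi>"
    using assms(2) range_T by blast
  moreover have "z *\<^sub>C v = T v - (T v - z *\<^sub>C v)" by simp
  ultimately have "z *\<^sub>C v = V (\<phi> - \<psi>)" by (metis V.diff)
  then have "V (inverse z *s (\<phi> - \<psi>)) = inverse z *\<^sub>C z *\<^sub>C v"
    by (simp only: V.scale)
  also have "\<dots> = v" using assms(1) by (simp add: scaleC_scaleC scaleC_one)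
  finally show ?thesis by (metis rangeI)
qed

lemma gen_eigenspace_eq:
  assumes "z \<noteq> 0"
  shows "gen_eigenspace T z = V ` matrix_gen_eigenspace B z"
proof -
  have "v \<in> range V" if "((\<lambda>w. T w - z *\<^sub>C w) ^^ k) v = 0" for k v
    using that
  proof (induction k arbitrary: v)
    case 0
    then show ?case by (metis V.zero funpow_0 rangeI)
  next
    case (Suc k)
    \<comment> \<open>The innermost factor is split off, so the induction hypothesis is applied to
      \<open>T v - z *\<^sub>C v\<close> instead of \<open>v\<close>.\<close>
    have "((\<lambda>w. T w - z *\<^sub>C w) ^^ k) (T v - z *\<^sub>C v) = 0"
      using Suc.prems by (simp only: funpow_Suc_right o_apply)
    then have "T v - z *\<^sub>C v \<in> range V" by (rule Suc.IH)
    with assms show ?case by (rule in_range_V)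
  qed
  moreover have "V \<psi> = 0 \<longleftrightarrow> \<psi> = 0" for \<psi>
    using V_inj by (metis V.zero injD)
  ultimately show ?thesis
    unfolding gen_eigenspace_def matrix_gen_eigenspace_def
    by (auto simp: funpow_T_V image_iff) (metis funpow_T_V rangeE)
qed

lemma eigenvalues_eq: "eigenvalues T - {0} = {z. z \<noteq> 0 \<and> (\<exists>\<psi>. \<psi> \<noteq> 0 \<and> B *v \<psi> = z *s \<psi>)}"
proof (intro set_eqI iffI)
  fix z assume "z \<in> eigenvalues T - {0}"
  then obtain v where z: "z \<noteq> 0" and v: "v \<noteq> 0" "T v = z *\<^sub>C v"
    by (auto simp: eigenvalues_def)
  have "T v - z *\<^sub>C v = V 0" using v(2) by simp
  then have "v \<in> range V" using in_range_V[OF z] by (metis rangeI)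
  then obtain \<psi> where \<psi>: "v = V \<psi>" by blast
  then have "V (B *v \<psi>) = V (z *s \<psi>)" using v(2) by (simp add: T_V V.scale)
  then have "B *v \<psi> = z *s \<psi>" using V_inj by (metis injD)
  moreover have "\<psi> \<noteq> 0" using v(1) \<psi> by auto
  ultimately show "z \<in> {z. z \<noteq> 0 \<and> (\<exists>\<psi>. \<psi> \<noteq> 0 \<and> B *v \<psi> = z *s \<psi>)}" using z by blast
next
  fix z assume "z \<in> {z. z \<noteq> 0 \<and> (\<exists>\<psi>. \<psi> \<noteq> 0 \<and> B *v \<psi> = z *s \<psi>)}"
  then obtain \<psi> where z: "z \<noteq> 0" and \<psi>: "\<psi> \<noteq> 0" "B *v \<psi> = z *s \<psi>" by blast
  have "V \<psi> \<noteq> 0" using V_inj \<psi>(1) by (metis V.zero injD)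
  moreover have "T (V \<psi>) = z *\<^sub>C V \<psi>" using \<psi>(2) by (simp add: T_V V.scale)
  ultimately show "z \<in> eigenvalues T - {0}" using z by (auto simp: eigenvalues_def)
qed

lemma cdim_gen_eigenspace:
  "z \<noteq> 0 \<Longrightarrow> cdim (gen_eigenspace T z) = vec.dim (matrix_gen_eigenspace B z)"
  by (simp add: gen_eigenspace_eq cdim_linear_image[OF V_linear V_inj])

end

section \<open>Matrices annihilated by a quadratic polynomial, with multiplicities fixed by the
  trace\<close>

locale quadratic_matrix =
  fixes B :: "complex^'n^'n" and c s :: complex
  assumes quadratic: "(B - mat c) ** (B - mat c) = mat (s\<^sup>2)"
    and trace: "trace B = of_nat CARD('n) * c"
begin

lemma quadratic_apply: "B *v (B *v \<psi>) = (2 * c) *s (B *v \<psi>) + (s\<^sup>2 - c\<^sup>2) *s \<psi>"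
proof -
  have "(B - mat c) *v ((B - mat c) *v \<psi>) = s\<^sup>2 *s \<psi>"
    using quadratic by (simp add: matrix_vector_mul_assoc)
  then show ?thesis
    by (simp add: matrix_vector_mult_diff_rdistrib vec.diff vec.scale vec_eq_iff algebra_simps
        power2_eq_square)
qed

lemma eigenvalue_cases:
  assumes "B *v \<psi> = z *s \<psi>" "\<psi> \<noteq> 0"
  shows "z = c + s \<or> z = c - s"
proof -
  have "(z\<^sup>2 - 2 * c * z - (s\<^sup>2 - c\<^sup>2)) *s \<psi> = 0"
    using quadratic_apply[of \<psi>] by (simp add: assms(1) vec.scale vec_eq_iff algebra_simps
        power2_eq_square)
  then have "(z - (c + s)) * (z - (c - s)) = 0"
    using assms(2) unfolding vec.scale_eq_0_iff by (simp add: algebra_simps power2_eq_square)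
  then show ?thesis by simp
qed

text \<open>The shifted map \<open>L\<close> satisfies \<open>L (L w) = (- 2 * s) *s L w\<close>
  with \<open>s \<noteq> 0\<close>, so its positive powers all have the same kernel. The dimension
  of that kernel is the trace of the projection onto it.\<close>

lemma gen_eigenspace_simple:
  assumes "s \<noteq> 0"
  shows "matrix_gen_eigenspace B (c + s) = {\<psi>. B *v \<psi> = (c + s) *s \<psi>}"
    and "2 * vec.dim (matrix_gen_eigenspace B (c + s)) = CARD('n)"
proof -
  define L where "L = (\<lambda>w. B *v w - (c + s) *s w)"
  have L2: "L (L w) = (- 2 * s) *s L w" for w
    by (simp add: L_def vec.diff vec.scale quadratic_apply vec_eq_iff algebra_simps
        power2_eq_square)
  have Lk: "(L ^^ Suc k) w = (- 2 * s) ^ k *s L w" for k w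
  proof (induction k arbitrary: w)
    case (Suc k)
    have "(L ^^ Suc (Suc k)) w = (L ^^ Suc k) (L w)"
      by (simp only: funpow_Suc_right o_apply)
    also have "\<dots> = (- 2 * s) ^ k *s L (L w)" by (rule Suc)
    finally show ?case by (simp add: L2 vec_eq_iff mult_ac)
  qed simp
  have "L \<psi> = 0" if "(L ^^ k) \<psi> = 0" for k \<psi>
  proof (cases k)
    case 0
    then show ?thesis using that by (simp add: L_def)
  next
    case (Suc m)
    then show ?thesis using that assms by (simp add: Lk del: funpow.simps)
  qed
  moreover have "(L ^^ 1) \<psi> = 0" if "L \<psi> = 0" for \<psi> using that by simp
  ultimately have "matrix_gen_eigenspace B (c + s) = {\<psi>. L \<psi> = 0}"
    unfolding matrix_gen_eigenspace_def L_def[symmetric] by blast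
  then show eq: "matrix_gen_eigenspace B (c + s) = {\<psi>. B *v \<psi> = (c + s) *s \<psi>}"
    by (simp add: L_def)
  \<comment> \<open>The spectral projection for \<open>c + s\<close>: the linear polynomial in
    \<open>B\<close> with value 1 at \<open>c + s\<close> and 0 at \<open>c - s\<close>.\<close>
  define Q where "Q = mat (1 / (2 * s)) ** (B - mat (c - s))"
  have Q: "Q *v w = (1 / (2 * s)) *s (B *v w - (c - s) *s w)" for w
    by (simp add: Q_def matrix_vector_mult_diff_rdistrib flip: matrix_vector_mul_assoc)
  have BQ: "B *v (Q *v w) = (c + s) *s (Q *v w)" for w
    unfolding Q vec.scale vec.diff quadratic_apply
    using assms by (simp add: vec_eq_iff field_simps power2_eq_square)
  have QE: "Q *v w = w" if "B *v w = (c + s) *s w" for w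
    using assms that by (simp add: Q vec_eq_iff field_simps)
  have range: "range ((*v) Q) = {\<psi>. B *v \<psi> = (c + s) *s \<psi>}"
  proof
    show "range ((*v) Q) \<subseteq> {\<psi>. B *v \<psi> = (c + s) *s \<psi>}"
      using BQ by blast
    show "{\<psi>. B *v \<psi> = (c + s) *s \<psi>} \<subseteq> range ((*v) Q)"
      using QE by (metis (mono_tags, lifting) mem_Collect_eq rangeI subsetI)
  qed
  have "Q ** Q = Q"
    unfolding matrix_eq by (simp add: QE BQ flip: matrix_vector_mul_assoc)
  from trace_idempotent[OF this] have "of_nat (2 * vec.dim (range ((*v) Q))) = 2 * trace Q"
    by simp
  also have "trace Q = 1 / (2 * s) * trace (B - mat (c - s))"
    by (simp only: Q_def trace_def mat_mult_nth sum_distrib_left)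
  also have "2 * \<dots> = of_nat CARD('n)"
    using assms by (simp add: trace_sub trace trace_mat field_simps)
  finally show "2 * vec.dim (matrix_gen_eigenspace B (c + s)) = CARD('n)"
    unfolding eq range of_nat_eq_iff .
qed

lemma gen_eigenspace_double:
  assumes "s = 0"
  shows "matrix_gen_eigenspace B c = UNIV"
proof -
  have "((\<lambda>w. B *v w - c *s w) ^^ 2) \<psi> = 0" for \<psi>
    using assms quadratic_apply[of \<psi>]
    by (simp add: numeral_2_eq_2 vec.diff vec.scale vec_eq_iff algebra_simps power2_eq_square)
  then show ?thesis
    unfolding matrix_gen_eigenspace_def by blast
qed

end

text \<open>Changing the sign of the root carries the results on \<open>c + s\<close> over to
  \<open>c - s\<close>.\<close>

lemma quadratic_matrix_uminus: "quadratic_matrix B c s \<Longrightarrow> quadratic_matrix B c (- s)"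
  by (simp add: quadratic_matrix_def)

lemma nonzero_eigenvalues_quadratic:
  fixes V :: "complex^4 \<Rightarrow> 'h::complex_hilbert"
  assumes "matrix_intertwiner T V B" "quadratic_matrix B c s"
  shows "nonzero_eigenvalues T = filter_mset (\<lambda>z. z \<noteq> 0) {#c + s, c + s, c - s, c - s#}"
proof -
  interpret matrix_intertwiner T V B by fact
  interpret Q: quadratic_matrix B c s by fact
  interpret Q': quadratic_matrix B c "- s"
    using Q.quadratic_matrix_axioms by (rule quadratic_matrix_uminus)
  have nontrivial: "\<exists>\<psi>. \<psi> \<noteq> 0 \<and> B *v \<psi> = z *s \<psi>"
    if "vec.dim {\<psi>. B *v \<psi> = z *s \<psi>} = 2" for z
  proof (rule ccontr)
    assume "\<not> ?thesis"
    then have "{\<psi>. B *v \<psi> = z *s \<psi>} \<subseteq> {0}" by blast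
    then have "vec.dim {\<psi>. B *v \<psi> = z *s \<psi>} \<le> vec.dim {0 :: complex^4}" by (rule vec.dim_subset)
    with that show False by simp
  qed
  show ?thesis
  proof (cases "s = 0")
    case False
    have dim: "vec.dim (matrix_gen_eigenspace B (c + s)) = 2"
      "vec.dim (matrix_gen_eigenspace B (c - s)) = 2"
      using Q.gen_eigenspace_simple(2) Q'.gen_eigenspace_simple(2) False by simp_all
    moreover have "matrix_gen_eigenspace B (c + s) = {\<psi>. B *v \<psi> = (c + s) *s \<psi>}"
      "matrix_gen_eigenspace B (c - s) = {\<psi>. B *v \<psi> = (c - s) *s \<psi>}"
      using Q.gen_eigenspace_simple(1) Q'.gen_eigenspace_simple(1) False by simp_all
    ultimately have "\<exists>\<psi>. \<psi> \<noteq> 0 \<and> B *v \<psi> = (c + s) *s \<psi>" "\<exists>\<psi>. \<psi> \<noteq> 0 \<and> B *v \<psi> = (c - s) *s \<psi>"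
      using nontrivial by metis+
    then have "eigenvalues T - {0} = {c + s, c - s} - {0}"
      unfolding eigenvalues_eq using Q.eigenvalue_cases by blast
    have "c + s \<noteq> c - s" using False by simp
    have "nonzero_eigenvalues T = (\<Sum>z\<in>{c + s, c - s} - {0}. replicate_mset 2 z)"
      unfolding nonzero_eigenvalues_def \<open>eigenvalues T - {0} = _\<close>
    proof (rule sum.cong[OF refl])
      fix z assume "z \<in> {c + s, c - s} - {0}"
      then have "z = c + s \<or> z = c - s" "z \<noteq> 0" by auto
      then have "cdim (gen_eigenspace T z) = 2"
        using dim cdim_gen_eigenspace by metis
      then show "replicate_mset (cdim (gen_eigenspace T z)) z = replicate_mset 2 z" by simp
    qed
    also have "\<dots> = filter_mset (\<lambda>z. z \<noteq> 0) {#a, a, b, b#}" if "a = c + s" "b = c - s" for a b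
      using \<open>c + s \<noteq> c - s\<close> unfolding that[symmetric]
      by (cases "a = 0"; cases "b = 0") (simp_all add: insert_Diff_if numeral_2_eq_2)
    finally show ?thesis by simp
  next
    case True
    have dim: "vec.dim (matrix_gen_eigenspace B c) = 4"
      unfolding Q.gen_eigenspace_double[OF True] vec_dim_card by simp
    have "z = c" if "B *v \<psi> = z *s \<psi>" "\<psi> \<noteq> 0" for z \<psi>
      using Q.eigenvalue_cases[OF that] True by simp
    moreover have "\<exists>\<psi>. \<psi> \<noteq> 0 \<and> B *v \<psi> = c *s \<psi>"
    proof (cases "\<forall>\<psi>. B *v \<psi> = c *s \<psi>")
      case True
      have "axis 1 1 \<noteq> (0 :: complex^4)" by (simp add: axis_eq_0_iff)
      with True show ?thesis by blast
    next
      case False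
      then obtain \<phi> where "B *v \<phi> - c *s \<phi> \<noteq> 0" by auto
      \<comment> \<open>For \<open>s = 0\<close> the map \<open>B - c\<close> squares to zero, so
        each of its non-zero values is an eigenvector, even if \<open>B\<close> is not
        diagonalizable.\<close>
      moreover have "B *v (B *v \<phi> - c *s \<phi>) = c *s (B *v \<phi> - c *s \<phi>)"
        using Q.quadratic_apply[of \<phi>] \<open>s = 0\<close>
        by (simp add: vec.diff vec.scale vec_eq_iff algebra_simps power2_eq_square)
      ultimately show ?thesis by blast
    qed
    ultimately have "eigenvalues T - {0} = {c} - {0}"
      unfolding eigenvalues_eq by auto
    then have "nonzero_eigenvalues T = (\<Sum>z\<in>{c} - {0}. replicate_mset 4 z)"
      unfolding nonzero_eigenvalues_def using dim cdim_gen_eigenspace[of c]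
      by (simp add: insert_Diff_if)
    then show ?thesis
      using True by (cases "c = 0") (simp_all add: insert_Diff_if numeral_eq_Suc)
  qed
qed

subsection \<open>The variance of the causal correlation operator\<close>

text \<open>The root of a non-positive number has real part zero, so the two numbers are complex
  conjugates.\<close>

lemma cmod_add_eq_cmod_diff:
  fixes c D :: real
  assumes "D \<le> 0"
  shows "cmod (of_real c + csqrt (of_real D)) = cmod (of_real c - csqrt (of_real D))"
  using assms by (simp add: cmod_def)

text \<open>The bound on \<open>D\<close> prevents \<open>c + s\<close> and \<open>c - s\<close>
  from having opposite signs, so their moduli differ by exactly \<open>2 * s\<close> up to
  sign.\<close>

lemma cmod_add_diff_csqrt:
  fixes c D :: real
  assumes "0 < D" "D \<le> c\<^sup>2"
  shows "(cmod (of_real c + csqrt (of_real D)) - cmod (of_real c - csqrt (of_real D)))\<^sup>2 = 4 * D"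
proof -
  define s where "s = sqrt D"
  have s: "s\<^sup>2 = D" "s > 0" "csqrt (of_real D) = of_real s"
    using assms by (simp_all add: s_def)
  then have "\<bar>s\<bar> \<le> \<bar>c\<bar>" using assms(2) by (simp only: abs_le_square_iff)
  have "cmod (of_real c + of_real s) = \<bar>c + s\<bar>" "cmod (of_real c - of_real s) = \<bar>c - s\<bar>"
    by (simp_all flip: of_real_add of_real_diff)
  moreover have "\<bar>c + s\<bar> - \<bar>c - s\<bar> = 2 * s \<or> \<bar>c + s\<bar> - \<bar>c - s\<bar> = - (2 * s)"
    using \<open>\<bar>s\<bar> \<le> \<bar>c\<bar>\<close> s(2) by linarith
  then have "(\<bar>c + s\<bar> - \<bar>c - s\<bar>)\<^sup>2 = (2 * s)\<^sup>2"
    by auto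
  ultimately show ?thesis using s by (simp add: power_mult_distrib)
qed

section \<open>The closed chain of two points in their spinor charts\<close>

context
  fixes x y :: "'h::complex_hilbert \<Rightarrow>\<^sub>L 'h" and U\<^sub>x U\<^sub>y :: "complex^4 \<Rightarrow> 'h" and p \<beta> and n :: nat
  assumes x: "x \<in> fermion_ops n" and y: "y \<in> fermion_ops n"
    and Ux: "spinor_identification x U\<^sub>x" and Uy: "spinor_identification y U\<^sub>y"
    and kernel: "\<And>\<psi>. fermionic_projector x y (U\<^sub>y \<psi>) = U\<^sub>x ((dirac_slash p + mat \<beta>) *v \<psi>)"
begin

interpretation x: spinor_chart n x U\<^sub>x
  using x Ux by unfold_locales

interpretation y: spinor_chart n y U\<^sub>y
  using y Uy by unfold_locales

abbreviation chain_matrix :: "complex^4^4" where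
  "chain_matrix \<equiv> (dirac_slash p + mat \<beta>) ** (dirac_slash (cnj_vec p) + mat (cnj \<beta>))"

lemma coord_y_kernel: "x.coord (y (U\<^sub>y \<psi>)) = (dirac_slash p + mat \<beta>) *v \<psi>"
  using kernel[of \<psi>] x.inj_U
  by (simp add: fermionic_projector_def x.spin_proj_eq inj_eq)

text \<open>The kernel with exchanged arguments is the spin adjoint: self-adjointness of
  \<open>x\<close> and \<open>y\<close> moves both operators to the other side, and
  \<open>dirac_inner_adjoint\<close> gives the matrix.\<close>

lemma coord_x_adjoint_kernel:
  "y.coord (x (U\<^sub>x \<phi>)) = (dirac_slash (cnj_vec p) + mat (cnj \<beta>)) *v \<phi>"
proof (rule y.coord_unique)
  fix \<psi>
  have "cinner (U\<^sub>y \<psi>) (y (x (U\<^sub>x \<phi>))) = cinner (x (y (U\<^sub>y \<psi>))) (U\<^sub>x \<phi>)"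
    by (simp add: x.cinner_X y.cinner_X)
  also have "\<dots> = cinner (U\<^sub>x ((dirac_slash p + mat \<beta>) *v \<psi>)) (x (U\<^sub>x \<phi>))"
    by (simp only: x.X_U_coord[symmetric, of "y (U\<^sub>y \<psi>)"] coord_y_kernel x.cinner_X)
  also have "\<dots> = dirac_inner \<psi> ((dirac_slash (cnj_vec p) + mat (cnj \<beta>)) *v \<phi>)"
    by (simp only: x.cinner_U_X_U dirac_inner_adjoint)
  finally show "cinner (U\<^sub>y \<psi>) (y (x (U\<^sub>x \<phi>))) =
      dirac_inner \<psi> ((dirac_slash (cnj_vec p) + mat (cnj \<beta>)) *v \<phi>)" .
qed

lemma closed_chain_eq: "closed_chain x y \<circ> spin_proj x = x.lift_matrix chain_matrix"
proof
  fix v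
  have "fermionic_projector y x (U\<^sub>x \<phi>) = U\<^sub>y ((dirac_slash (cnj_vec p) + mat (cnj \<beta>)) *v \<phi>)" for \<phi>
    by (simp add: fermionic_projector_def y.spin_proj_eq coord_x_adjoint_kernel)
  then show "(closed_chain x y \<circ> spin_proj x) v = x.lift_matrix chain_matrix v"
    by (simp add: closed_chain_def compose_def x.spin_proj_eq kernel x.lift_matrix_def
        matrix_vector_mul_assoc)
qed

text \<open>\<open>x\<close> conjugates the closed chain on the spin space of \<open>x\<close> to \<open>xy\<close>.\<close>

lemma matrix_intertwiner_xy: "matrix_intertwiner (x o\<^sub>L y) (\<lambda>\<psi>. x (U\<^sub>x \<psi>)) chain_matrix"
proof (rule matrix_intertwiner.intro)
  show "Vector_Spaces.linear (*s) (*\<^sub>C) (\<lambda>\<psi>. x (U\<^sub>x \<psi>))"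
    using Vector_Spaces.linear_compose[OF x.U.linear_axioms x.X.linear_axioms] by (simp add: o_def)
  show "inj (\<lambda>\<psi>. x (U\<^sub>x \<psi>))" by (rule x.inj_X_U)
  show "range (x o\<^sub>L y) \<subseteq> range (\<lambda>\<psi>. x (U\<^sub>x \<psi>))"
    unfolding x.range_X_U by auto
  show "(x o\<^sub>L y) (x (U\<^sub>x \<psi>)) = x (U\<^sub>x (chain_matrix *v \<psi>))" for \<psi>
  proof -
    \<comment> \<open>The operator \<open>y\<close> does not distinguish a vector from its
      projection onto the spin space of \<open>y\<close>; below, the same is used for
      \<open>x\<close>.\<close>
    have "y (x (U\<^sub>x \<psi>)) = y (U\<^sub>y ((dirac_slash (cnj_vec p) + mat (cnj \<beta>)) *v \<psi>))"
      by (metis y.X_U_coord coord_x_adjoint_kernel)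
    then have "x (y (x (U\<^sub>x \<psi>))) = x (U\<^sub>x (x.coord (y
        (U\<^sub>y ((dirac_slash (cnj_vec p) + mat (cnj \<beta>)) *v \<psi>)))))"
      by (simp only: x.X_U_coord)
    then show ?thesis
      by (simp add: coord_y_kernel matrix_vector_mul_assoc)
  qed
qed

text \<open>Subtracting a multiple of \<open>spin_proj x\<close> amounts to subtracting a scalar
  matrix in the chart. The normalization 1/4 of the expectation cancels the trace 4 of the identity
  matrix.\<close>

lemma variance_total_lift_matrix:
  assumes "separable_space (euclidean :: 'h topology)"
    and "trace N = 4 * c" "(N - mat c) ** (N - mat c) = mat D"
  shows "variance_total 2 x (x.lift_matrix N) = D"
proof -
  have "expectation_total 2 (x.lift_matrix N) = c"
    by (simp add: expectation_total_def x.hilbert_trace_lift_matrix[OF assms(1)] assms(2))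
  moreover have "x.lift_matrix N v - c *\<^sub>C spin_proj x v = x.lift_matrix (N - mat c) v" for v
    by (simp add: x.lift_matrix_def x.spin_proj_eq matrix_vector_mult_diff_rdistrib
        x.U.diff x.U.scale)
  moreover have "x.lift_matrix (N - mat c) ^^ 2 = x.lift_matrix (mat D)"
    by (rule ext) (simp add: numeral_2_eq_2 x.lift_matrix_comp assms(3))
  ultimately show ?thesis
    by (simp add: variance_total_def expectation_total_def[of 2 "x.lift_matrix (mat D)"]
        x.hilbert_trace_lift_matrix[OF assms(1)] trace_mat)
qed

lemma lagrangian_eq_variance:
  assumes "separable_space (euclidean :: 'h topology)"
  shows "complex_of_real (lagrangian 2 x y) = 4 * variance_total 2 x (causal_correlation 2 x y)"
proof -
  obtain c D :: real where cD: "trace chain_matrix = 4 * complex_of_real c"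
    "(chain_matrix - mat (of_real c)) ** (chain_matrix - mat (of_real c)) = mat (complex_of_real D)"
    "D \<le> c\<^sup>2"
    by (rule dirac_chain_quadratic)
  \<comment> \<open>The complex root covers negative \<open>D\<close> as well.\<close>
  define s where "s = csqrt (of_real D)"
  define a where "a = complex_of_real c + s"
  define b where "b = complex_of_real c - s"
  have "quadratic_matrix chain_matrix (of_real c) s"
    using cD(1,2) by unfold_locales (simp_all add: s_def)
  with matrix_intertwiner_xy
  have "nonzero_eigenvalues (x o\<^sub>L y) = filter_mset (\<lambda>z. z \<noteq> 0) {#a, a, b, b#}"
    unfolding a_def b_def by (rule nonzero_eigenvalues_quadratic)
  \<comment> \<open>Padding with zeros restores exactly the eigenvalues that the filter
    removed.\<close>
  then have E: "causal_eigenvalues 2 x y = {#a, a, b, b#}"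
    unfolding causal_eigenvalues_def Let_def
    by (cases "a = 0"; cases "b = 0") (simp_all add: numeral_eq_Suc)
  have spacelike: "spacelike 2 x y \<longleftrightarrow> cmod a = cmod b"
    unfolding spacelike_def E by auto
  \<comment> \<open>Among the 16 ordered pairs, 8 combine \<open>a\<close> with \<open>b\<close>;
    this cancels the prefactor 1/8.\<close>
  have lagrangian: "lagrangian 2 x y = (cmod a - cmod b)\<^sup>2"
    unfolding lagrangian_def E by (simp add: power2_commute[of "cmod b"])
  show ?thesis
  proof (cases "spacelike 2 x y")
    case True
    have "hilbert_trace (\<lambda>v::'h. 0) = 0" by (simp add: hilbert_trace_def)
    then have "variance_total 2 x (\<lambda>v. 0) = 0"
      by (simp add: variance_total_def expectation_total_def numeral_2_eq_2 o_def)
    with True show ?thesis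
      by (simp add: causal_correlation_def lagrangian spacelike)
  next
    case False
    \<comment> \<open>For \<open>D \<le> 0\<close> the moduli would agree, which would make the
      points spacelike separated.\<close>
    then have "D > 0"
      using cmod_add_eq_cmod_diff[of D c] unfolding spacelike a_def b_def s_def by linarith
    have "lagrangian 2 x y = 4 * D"
      unfolding lagrangian a_def b_def s_def using \<open>D > 0\<close> cD(3) by (rule cmod_add_diff_csqrt)
    moreover have "variance_total 2 x (causal_correlation 2 x y) = of_real D"
      using False variance_total_lift_matrix[OF assms cD(1,2)]
      by (simp add: causal_correlation_def closed_chain_eq)
    ultimately show ?thesis by simp
  qed
qed

end

theorem proposition4p1:
  fixes \<rho> :: "('h::complex_hilbert \<Rightarrow>\<^sub>L 'h) measure"
    and x y :: "'h \<Rightarrow>\<^sub>L 'h"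
    and U\<^sub>x U\<^sub>y :: "complex^4 \<Rightarrow> 'h"
    and \<alpha> \<beta> :: complex
    and \<xi> :: "complex^4"
  assumes "causal_fermion_system 2 \<rho>"
    and "regular_point 2 x"
    and "regular_point 2 y"
    and "spinor_identification x U\<^sub>x"
    and "spinor_identification y U\<^sub>y"
    and "\<And>\<psi>. fermionic_projector x y (U\<^sub>y \<psi>) =
                U\<^sub>x ((mat (\<i> * \<alpha>) ** dirac_slash \<xi> + mat \<beta>) *v \<psi>)"
  shows "complex_of_real (lagrangian 2 x y) =
           4 * variance_total 2 x (causal_correlation 2 x y)"
proof (rule lagrangian_eq_variance[where n = 2])
  show "x \<in> fermion_ops 2" "y \<in> fermion_ops 2"
    using assms(2,3) by (simp_all add: regular_point_def)
  show "separable_space (euclidean :: 'h topology)"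
    using assms(1) by (simp add: causal_fermion_system_def)
  \<comment> \<open>The factor \<open>\<i> * \<alpha>\<close> is absorbed into the complex vector,
    giving the form of the kernel assumed above.\<close>
  show "fermionic_projector x y (U\<^sub>y \<psi>) =
      U\<^sub>x ((dirac_slash ((\<i> * \<alpha>) *s \<xi>) + mat \<beta>) *v \<psi>)" for \<psi>
    using assms(6) by (simp only: dirac_slash_scale)
qed (fact assms)+

end
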